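(* Let $n$ be a positive integer that is not a perfect square. Then for each $k\in\{1,2,3,4\}$, $$\overline{SOME}(4^{k-1}n)\equiv 0\pmod{2^{2k+1}}.$$
   Context: An overpartition of a nonnegative integer $n$ is a partition of $n$ in which the first occurrence of each distinct part may be overlined (or not). For $n\ge 0$, $\overline{SOME}(n)$ denotes the sum, over all overpartitions $\lambda$ of $n$, of (the sum of the odd parts of $\lambda$) minus (the sum of the even parts of $\lambda$), where parts are counted with multiplicity and an overlined part counts with its numerical size. *)

theory Defs
  imports
    "HOL-Library.Multiset"
    "HOL-Number_Theory.Number_Theory"
    "HOL-Computational_Algebra.Nth_Powers"
begin

definition partitions :: "nat \<Rightarrow> nat multiset set" where
  "partitions n = {P. 0 \<notin># P \<and> \<Sum>\<^sub># P = n}"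

text \<open>
  An overpartition is encoded as a pair \<open>(P, S)\<close>: the multiset \<open>P\<close> contains all its parts,
  overlined or not, by numerical size, and \<open>S\<close> is the set of those part sizes whose first
  occurrence is overlined.
\<close>

definition overpartitions :: "nat \<Rightarrow> (nat multiset \<times> nat set) set" where
  "overpartitions n = {(P, S). P \<in> partitions n \<and> S \<subseteq> set_mset P}"

definition SOME_overline :: "nat \<Rightarrow> int" where
  "SOME_overline n =
     (\<Sum>(P, S)\<in>overpartitions n.
        int (\<Sum>\<^sub># (filter_mset odd P)) - int (\<Sum>\<^sub># (filter_mset even P)))"

text \<open>
  The sum above ranges over a finite set, so it is not subject to the convention that sums
  over infinite sets vanish.
\<close>

lemma finite_partitions: "finite (partitions n)"
proof (rule finite_subset)
  show "partitions n \<subseteq> mset ` {xs. set xs \<subseteq> {..n} \<and> length xs \<le> n}"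
  proof
    fix P assume P: "P \<in> partitions n"
    obtain xs where xs: "P = mset xs" by (metis ex_mset)
    have pos: "0 \<notin> set xs" and sum: "sum_list xs = n"
      using P by (auto simp: partitions_def xs sum_mset_sum_list)
    have "length ys \<le> sum_list ys" if "0 \<notin> set ys" for ys :: "nat list"
      using that by (induction ys) auto
    then have "length xs \<le> n" using pos sum by blast
    moreover have "set xs \<subseteq> {..n}"
      using sum member_le_sum_list by fastforce
    ultimately show "P \<in> mset ` {xs. set xs \<subseteq> {..n} \<and> length xs \<le> n}"
      using xs by blast
  qed
  show "finite (mset ` {xs. set xs \<subseteq> {..n} \<and> length xs \<le> n})"
    by (intro finite_imageI finite_lists_length_le) simp
qed

lemma finite_overpartitions: "finite (overpartitions n)"
proof -
  have "overpartitions n = Sigma (partitions n) (\<lambda>P. Pow (set_mset P))"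
    by (auto simp: overpartitions_def)
  then show ?thesis by (simp add: finite_partitions finite_SigmaI)
qed

end

theory Submission
  imports
    Defs
    "HOL-Computational_Algebra.Formal_Power_Series"
begin

text \<open>
  Write \<open>P(q)\<close> for the generating function of overpartitions (\<open>opf\<close>), \<open>\<theta>(q)\<close> for the sum of
  \<open>q^(j^2)\<close> over all integers \<open>j\<close> (\<open>theta_fps\<close>), and \<open>W(q)\<close> for the sum of \<open>j^2 q^(j^2)\<close> over
  \<open>j \<ge> 1\<close> (\<open>square_fps\<close>). Below, \<open>V\<close> and \<open>b\<close> are \<open>odd_square_fps\<close> and \<open>odd_theta_fps\<close>.

  An overpartition is a pair of one with odd parts and one with even parts, so \<open>P = P1 P2\<close> with
  \<open>P2(q) = P(q^2)\<close>, and with \<open>D = q d/dq\<close> the statistic has the generating function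
  \<open>D(P1) P2 - P1 D(P2) = P2^2 D(P1 / P2)\<close>. Gauss's identity \<open>P(q) \<theta>(-q) = 1\<close> and
  \<open>P1(q) P1(-q) = 1\<close> yield \<open>P1 = \<theta> P2\<close>. The quotient \<open>P1 / P2\<close> is therefore \<open>\<theta>\<close>, and the
  generating function is \<open>D(\<theta>) P(q^2)^2 = 2 W(q) P(q^2)^2\<close> (lemma \<open>SOME_overline_fps\<close>).

  The coefficients of \<open>W\<close> live on the squares, and both \<open>P\<close> and \<open>\<theta>\<close> are 1 modulo 2, so that their
  even powers are 1 modulo 4. For \<open>k = 1\<close> this settles the claim: modulo 8 only \<open>2 W\<close> is left, whose
  coefficient at a nonsquare vanishes. For larger \<open>k\<close> the exponents divisible by 4 are extracted.
  Here \<open>\<theta> = a + 2 b\<close> with \<open>a = \<theta>(q^4)\<close> and with \<open>b\<close> supported on exponents that are 1 modulo 8,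
  \<open>W = V + 4 W(q^4)\<close> with \<open>V\<close> supported on the same exponents as \<open>b\<close>, and iterating
  \<open>P = \<theta> P(q^2)^2\<close> gives \<open>P = \<theta> \<theta>(q^2)^2 P(q^4)^4\<close>, where \<open>\<theta>(q^2)^2 = a^2 + 4 b^2\<close>. Counting
  factors \<open>b\<close> and \<open>V\<close> modulo 4 tells which terms reach an exponent divisible by 4. The first
  extraction is exact: the coefficient at \<open>4 n\<close> is 8 times that of \<open>W \<theta>^2 P^4\<close> at \<open>n\<close>
  (lemma \<open>SOME_overline_4\<close>), which settles \<open>k = 2\<close> because \<open>\<theta>^2 P^4\<close> is 1 modulo 4.

  Extracting once more from \<open>W \<theta>^2 P^4 = W \<theta>^6 \<theta>(q^2)^8 P(q^4)^16\<close>, almost everything vanishes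
  modulo 64: what survives at \<open>4 n\<close> is \<open>352 b^4\<close> at \<open>4 n\<close> and 4 times \<open>W \<theta>^14 P^16\<close> at \<open>n\<close>
  (lemma \<open>square_theta_opf_nth_4\<close>). This settles \<open>k = 3\<close>, where 16 is enough. For \<open>k = 4\<close> the
  series \<open>b^4\<close> contributes nothing, since its exponents are 4 modulo 8, the factor \<open>P^16\<close> is 1
  modulo 16, and a last extraction from \<open>W \<theta>^14\<close> gives another factor 4
  (lemma \<open>square_theta14_nth_4\<close>) on top of the one coming from the nonsquare \<open>n\<close>.
\<close>

unbundle fps_syntax

section \<open>Dilation and reflection of power series\<close>

abbreviation dilate :: "nat \<Rightarrow> int fps \<Rightarrow> int fps" where
  "dilate k f \<equiv> f oo fps_X ^ k"

abbreviation reflect :: "int fps \<Rightarrow> int fps" where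
  "reflect f \<equiv> f oo (- fps_X)"

lemma dilate_nth:
  assumes "k > 0"
  shows "dilate k f $ n = (if k dvd n then f $ (n div k) else 0)"
proof -
  have "dilate k f $ n = (\<Sum>i=0..n. if n = k * i then f $ i else 0)"
    unfolding fps_compose_nth by (simp add: power_mult[symmetric] if_distrib cong: if_cong)
  also have "\<dots> = (\<Sum>i\<in>{0..n} \<inter> {i. n = k * i}. f $ i)"
    by (simp add: sum.inter_restrict)
  also have "{0..n} \<inter> {i. n = k * i} = (if k dvd n then {n div k} else {})"
    using assms by (auto elim!: dvdE)
  finally show ?thesis by simp
qed

lemma reflect_nth: "reflect f $ n = (-1) ^ n * f $ n"
proof -
  have *: "(- fps_X :: int fps) ^ i = fps_const ((-1) ^ i) * fps_X ^ i" for i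
    by (induction i) (simp_all add: algebra_simps flip: fps_const_neg)
  have "reflect f $ n = (\<Sum>i=0..n. if i = n then (-1) ^ i * f $ i else 0)"
    unfolding fps_compose_nth * by (intro sum.cong) auto
  also have "\<dots> = (-1) ^ n * f $ n" by simp
  finally show ?thesis .
qed

lemma dilate_mult: "k > 0 \<Longrightarrow> dilate k (f * g) = dilate k f * dilate k g"
  by (rule fps_compose_mult_distrib) simp

lemma dilate_power: "k > 0 \<Longrightarrow> dilate k (f ^ n) = dilate k f ^ n"
  by (rule fps_compose_power[symmetric]) simp

lemma reflect_mult: "reflect (f * g) = reflect f * reflect g"
  by (rule fps_compose_mult_distrib) simp

lemma reflect_power: "reflect (f ^ n) = reflect f ^ n"
  by (rule fps_compose_power[symmetric]) simp

lemma reflect_reflect: "reflect (reflect f) = f"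
  by (rule fps_ext) (simp add: reflect_nth flip: power_mult_distrib mult.assoc)

lemma dilate_dilate: "k > 0 \<Longrightarrow> l > 0 \<Longrightarrow> dilate k (dilate l f) = dilate (k * l) f"
  by (rule fps_ext) (auto simp: dilate_nth div_mult2_eq dest: dvd_mult_left elim!: dvdE)

lemma reflect_dilate_even: "k > 0 \<Longrightarrow> even k \<Longrightarrow> reflect (dilate k f) = dilate k f"
  by (rule fps_ext) (auto simp: reflect_nth dilate_nth elim!: dvdE)

lemma fps_numeral_mult_nth: "(numeral w * f :: int fps) $ n = numeral w * f $ n"
  by (simp add: numeral_fps_const)

lemma fps_XD_mult: "fps_XD (f * g) = fps_XD f * g + f * fps_XD (g :: int fps)"
  by (simp add: fps_XD_def algebra_simps)

section \<open>Generating functions of overpartitions\<close>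

definition partitions_in :: "nat set \<Rightarrow> nat \<Rightarrow> nat multiset set" where
  "partitions_in A n = {P \<in> partitions n. set_mset P \<subseteq> A}"

text \<open>
  A partition carries one overpartition for every subset of its distinct part sizes, whence the
  weight. The set \<open>A\<close> restricts the part sizes. Since 0 is never a part, \<open>A = UNIV\<close> gives all
  overpartitions.
\<close>

definition overpartition_fps :: "nat set \<Rightarrow> int fps" where
  "overpartition_fps A = Abs_fps (\<lambda>n. \<Sum>P\<in>partitions_in A n. 2 ^ card (set_mset P))"

lemma finite_partitions_in: "finite (partitions_in A n)"
  using finite_partitions by (simp add: partitions_in_def)

text \<open>
  Splitting a partition into its parts from \<open>A\<close> and from \<open>B\<close> is a bijection and multiplies the
  weights. The function \<open>h\<close> of the two part sums is what lets the same bijection serve both for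
  the product formula (\<open>h = 1\<close>) and for the difference of part sums.
\<close>

lemma sum_partitions_in_Un:
  fixes h :: "nat \<Rightarrow> nat \<Rightarrow> int"
  assumes "A \<inter> B = {}"
  shows "(\<Sum>P\<in>partitions_in (A \<union> B) n. 2 ^ card (set_mset P)
            * h (\<Sum>\<^sub># (filter_mset (\<lambda>x. x \<in> A) P)) (\<Sum>\<^sub># (filter_mset (\<lambda>x. x \<in> B) P)))
       = (\<Sum>i=0..n. h i (n - i) * (overpartition_fps A $ i * overpartition_fps B $ (n - i)))"
proof -
  let ?fA = "filter_mset (\<lambda>x. x \<in> A)" and ?fB = "filter_mset (\<lambda>x. x \<in> B)"
  let ?w = "\<lambda>P. 2 ^ card (set_mset P) :: int"
  have fA: "?fA P = P" "?fB P = {#}" if "set_mset P \<subseteq> A" for P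
    using that assms by (auto simp: filter_mset_eq_conv)
  have fB: "?fB P = P" "?fA P = {#}" if "set_mset P \<subseteq> B" for P
    using that assms by (auto simp: filter_mset_eq_conv)
  have split: "?fA P + ?fB P = P" if "set_mset P \<subseteq> A \<union> B" for P
  proof -
    have "?fB P = filter_mset (\<lambda>x. x \<notin> A) P"
      using that assms by (intro filter_mset_cong) auto
    then show ?thesis by (metis multiset_partition)
  qed
  have split_sum: "\<Sum>\<^sub># P = \<Sum>\<^sub># (?fA P) + \<Sum>\<^sub># (?fB P)" if "set_mset P \<subseteq> A \<union> B" for P
    using split[OF that] by (metis sum_mset.union)
  have card: "card (set_mset (P + Q)) = card (set_mset P) + card (set_mset Q)"
    if "set_mset P \<subseteq> A" "set_mset Q \<subseteq> B" for P Q
    using that assms by (simp, intro card_Un_disjoint) auto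
  have "(\<Sum>P\<in>partitions_in (A \<union> B) n. ?w P * h (\<Sum>\<^sub># (?fA P)) (\<Sum>\<^sub># (?fB P))) =
    (\<Sum>(i, P, Q)\<in>(SIGMA i:{0..n}. partitions_in A i \<times> partitions_in B (n - i)).
        h i (n - i) * (?w P * ?w Q))"
    apply (rule sum.reindex_bij_witness[where i = "\<lambda>(i, P, Q). P + Q"
          and j = "\<lambda>P. (\<Sum>\<^sub># (?fA P), ?fA P, ?fB P)"])
    subgoal by (auto simp: partitions_in_def split)
    subgoal by (auto simp: partitions_in_def partitions_def split_sum)
    subgoal by (auto simp: partitions_in_def partitions_def fA fB)
    subgoal by (auto simp: partitions_in_def partitions_def)
    subgoal for P
    proof -
      assume "P \<in> partitions_in (A \<union> B) n"
      then have P: "set_mset P \<subseteq> A \<union> B" "\<Sum>\<^sub># P = n"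
        by (auto simp: partitions_in_def partitions_def)
      have "card (set_mset P) = card (set_mset (?fA P)) + card (set_mset (?fB P))"
        using card[of "?fA P" "?fB P"] split[OF P(1)] by (simp add: subset_iff)
      then show ?thesis
        using split_sum[OF P(1)] P(2) by (simp add: power_add)
    qed
    done
  also have "\<dots> = (\<Sum>i=0..n. h i (n - i) * (\<Sum>(P, Q)\<in>partitions_in A i \<times> partitions_in B (n - i).
      ?w P * ?w Q))"
    by (subst sum.Sigma[symmetric])
       (auto simp: finite_partitions_in sum_distrib_left case_prod_unfold intro!: sum.cong)
  also have "\<dots> = (\<Sum>i=0..n. h i (n - i) * (overpartition_fps A $ i * overpartition_fps B $ (n - i)))"
    by (simp add: overpartition_fps_def sum_product sum.cartesian_product)
  finally show ?thesis .
qed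

lemma overpartition_fps_Un:
  "A \<inter> B = {} \<Longrightarrow> overpartition_fps (A \<union> B) = overpartition_fps A * overpartition_fps B"
  using sum_partitions_in_Un[of A B "\<lambda>_ _. 1"]
  by (intro fps_ext) (simp add: fps_mult_nth, simp add: overpartition_fps_def)

lemma partitions_in_singleton:
  assumes "m > 0"
  shows "partitions_in {m} n = (if m dvd n then {replicate_mset (n div m) m} else {})"
proof -
  have "P \<in> partitions_in {m} n \<longleftrightarrow> m dvd n \<and> P = replicate_mset (n div m) m" for P
  proof
    assume P: "P \<in> partitions_in {m} n"
    then have "P = replicate_mset (size P) m"
      by (intro set_mset_subset_singletonD) (simp add: partitions_in_def)
    moreover have "n = \<Sum>\<^sub># P"
      using P by (simp add: partitions_in_def partitions_def)
    ultimately have "P = replicate_mset (size P) m" "n = size P * m"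
      by (simp, metis sum_mset_replicate_mset of_nat_id)
    then show "m dvd n \<and> P = replicate_mset (n div m) m" using assms by auto
  next
    assume "m dvd n \<and> P = replicate_mset (n div m) m"
    then show "P \<in> partitions_in {m} n" using assms
      by (auto simp: partitions_in_def partitions_def split: if_splits)
  qed
  then show ?thesis by auto
qed

lemma overpartition_fps_singleton:
  assumes "m > 0"
  shows "(1 - fps_X ^ m) * overpartition_fps {m} = 1 + fps_X ^ m"
proof (rule fps_ext)
  fix n
  have nth: "overpartition_fps {m} $ n = (if n = 0 then 1 else if m dvd n then 2 else 0)" for n
    using assms by (auto simp: overpartition_fps_def partitions_in_singleton elim!: dvdE)
  show "((1 - fps_X ^ m) * overpartition_fps {m}) $ n = (1 + fps_X ^ m) $ n"
    using assms by (auto simp: left_diff_distrib fps_X_power_mult_nth nth dvd_minus_self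
         not_less elim: dvdE)
qed

lemma overpartition_fps_insert:
  assumes "m > 0" "m \<notin> A"
  shows "(1 - fps_X ^ m) * overpartition_fps (insert m A) = (1 + fps_X ^ m) * overpartition_fps A"
  using overpartition_fps_Un[of "{m}" A] overpartition_fps_singleton[OF assms(1)] assms(2)
  by (simp add: mult.assoc[symmetric])

text \<open>
  Parts above \<open>n\<close> cannot occur in a partition of \<open>n\<close>. Identities for infinite sets of parts are
  reduced in this way to finite ones, which can be built up one part at a time.
\<close>

lemma overpartition_fps_nth_cong:
  assumes "A \<inter> {1..n} = B \<inter> {1..n}"
  shows "overpartition_fps A $ n = overpartition_fps B $ n"
proof -
  have bound: "x \<in> {1..n}" if "P \<in> partitions n" "x \<in># P" for x P
  proof -
    obtain Q where "P = add_mset x Q" using \<open>x \<in># P\<close> by (blast dest: multi_member_split)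
    with that(1) have "x \<noteq> 0" "x \<le> n" by (auto simp: partitions_def)
    then show ?thesis by simp
  qed
  have "set_mset P \<subseteq> A \<longleftrightarrow> set_mset P \<subseteq> B" if "P \<in> partitions n" for P
    using bound[OF that] assms by blast
  then have "partitions_in A n = partitions_in B n"
    unfolding partitions_in_def by blast
  then show ?thesis by (simp add: overpartition_fps_def)
qed

lemma overpartition_fps_empty: "overpartition_fps {} = 1"
proof (rule fps_ext)
  fix n
  have "partitions_in {} n = (if n = 0 then {{#}} else {})"
    by (auto simp: partitions_in_def partitions_def)
  then show "overpartition_fps {} $ n = 1 $ n" by (simp add: overpartition_fps_def)
qed

text \<open>
  Halving all parts preserves the number of distinct parts.
\<close>

lemma overpartition_fps_even: "overpartition_fps {m. even m} = dilate 2 (overpartition_fps UNIV)"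
proof (rule fps_ext)
  fix n :: nat
  let ?d = "image_mset ((*) (2::nat))" and ?h = "image_mset (\<lambda>x::nat. x div 2)"
  have dh: "?d (?h P) = P" if "set_mset P \<subseteq> {m. even m}" for P
  proof -
    have "?d (?h P) = image_mset (\<lambda>x. x) P"
      unfolding multiset.map_comp using that by (intro image_mset_cong) auto
    then show ?thesis by simp
  qed
  have hd: "?h (?d P) = P" for P
    by (simp add: multiset.map_comp comp_def)
  have sum_d: "\<Sum>\<^sub># (?d P) = 2 * \<Sum>\<^sub># P" for P
    by (induction P) simp_all
  show "overpartition_fps {m. even m} $ n = dilate 2 (overpartition_fps UNIV) $ n"
  proof (cases "even n")
    case False
    have "partitions_in {m. even m} n = {}"
    proof (rule ccontr)
      assume "partitions_in {m. even m} n \<noteq> {}"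
      then obtain P where "set_mset P \<subseteq> {m. even m}" "\<Sum>\<^sub># P = n"
        by (auto simp: partitions_in_def partitions_def)
      with dh[of P] sum_d[of "?h P"] False show False by auto
    qed
    with False show ?thesis by (simp add: overpartition_fps_def dilate_nth)
  next
    case True
    have "(\<Sum>P\<in>partitions_in {m. even m} n. 2 ^ card (set_mset P) :: int)
        = (\<Sum>P\<in>partitions_in UNIV (n div 2). 2 ^ card (set_mset P))"
    proof (rule sum.reindex_bij_witness[where i = ?d and j = ?h])
      fix P assume P: "P \<in> partitions_in {m. even m} n"
      then have P': "set_mset P \<subseteq> {m. even m}" "\<Sum>\<^sub># P = n" "0 \<notin># P"
        by (auto simp: partitions_in_def partitions_def)
      show "?d (?h P) = P" using dh P' by simp
      have "0 \<notin># ?h P"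
      proof
        assume "0 \<in># ?h P"
        then obtain x where "x \<in># P" "x div 2 = 0" by auto
        with P'(1,3) show False by (cases "x = 0") (auto elim!: evenE)
      qed
      then show "?h P \<in> partitions_in UNIV (n div 2)"
        using P' dh[of P] sum_d[of "?h P"] by (auto simp: partitions_in_def partitions_def)
      have "inj_on (\<lambda>x. x div 2) (set_mset P)"
        using P' by (intro inj_onI) (metis subsetD dvd_mult_div_cancel mem_Collect_eq)
      then show "2 ^ card (set_mset (?h P)) = (2 ^ card (set_mset P) :: int)"
        by (simp add: card_image)
    next
      fix P assume "P \<in> partitions_in UNIV (n div 2)"
      then show "?h (?d P) = P" "?d P \<in> partitions_in {m. even m} n"
        using hd sum_d[of P] True by (auto simp: partitions_in_def partitions_def)
    qed
    with True show ?thesis by (simp add: overpartition_fps_def dilate_nth)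
  qed
qed

text \<open>
  Multiplication of the coefficient at \<open>n\<close> by \<open>n\<close> is the operator \<open>fps_XD\<close>, so weighting by the sum
  of the odd (even) parts differentiates the factor of the odd (even) parts.
\<close>

lemma SOME_overline_eq:
  "SOME_overline n = (fps_XD (overpartition_fps {m. odd m}) * overpartition_fps {m. even m}
     - overpartition_fps {m. odd m} * fps_XD (overpartition_fps {m. even m})) $ n"
proof -
  let ?O = "{m. odd m}" and ?E = "{m::nat. even m}"
  have "overpartitions n = Sigma (partitions n) (\<lambda>P. Pow (set_mset P))"
    by (auto simp: overpartitions_def)
  then have "SOME_overline n = (\<Sum>P\<in>partitions n. \<Sum>S\<in>Pow (set_mset P).
        int (\<Sum>\<^sub># (filter_mset odd P)) - int (\<Sum>\<^sub># (filter_mset even P)))"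
    unfolding SOME_overline_def by (subst sum.Sigma) (simp_all add: finite_partitions)
  also have "\<dots> = (\<Sum>P\<in>partitions_in (?O \<union> ?E) n. 2 ^ card (set_mset P) *
     (int (\<Sum>\<^sub># (filter_mset (\<lambda>x. x \<in> ?O) P)) - int (\<Sum>\<^sub># (filter_mset (\<lambda>x. x \<in> ?E) P))))"
    by (rule sum.cong) (auto simp: card_Pow partitions_in_def)
  also have "\<dots> = (\<Sum>i=0..n. (int i - int (n - i)) *
      (overpartition_fps ?O $ i * overpartition_fps ?E $ (n - i)))"
    by (rule sum_partitions_in_Un[of ?O ?E "\<lambda>i j. int i - int j"]) auto
  also have "\<dots> = (fps_XD (overpartition_fps ?O) * overpartition_fps ?E
     - overpartition_fps ?O * fps_XD (overpartition_fps ?E)) $ n"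
    unfolding fps_sub_nth fps_mult_nth fps_XD_nth sum_subtractf[symmetric]
    by (intro sum.cong) (simp_all add: algebra_simps)
  finally show ?thesis .
qed

section \<open>Gauss's theta identity\<close>

abbreviation overpartitions_upto_fps :: "nat \<Rightarrow> int fps" where
  "overpartitions_upto_fps n \<equiv> overpartition_fps {1..n}"

lemma overpartitions_upto_fps_Suc:
  "(1 - fps_X ^ Suc n) * overpartitions_upto_fps (Suc n)
     = (1 + fps_X ^ Suc n) * overpartitions_upto_fps n"
proof -
  have "{1..Suc n} = insert (Suc n) {1..n}" by auto
  then show ?thesis
    using overpartition_fps_insert[of "Suc n" "{1..n}"] by (simp only:) simp
qed

text \<open>
  The proof of Gauss's identity follows Shanks's method: a finite form of the identity whose error
  terms are explicit and telescope from one truncation to the next. With the product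
  \<open>(1 + q)...(1 + q^s) / ((1 - q)...(1 - q^s))\<close> counting overpartitions into parts at most \<open>s\<close>, the
  series below is the product for \<open>s\<close> times \<open>2 / (1 + q^s)\<close>; written as a sum it needs no division,
  and the value at \<open>s = 0\<close> is consistent with that formula.
\<close>

definition shanks_term :: "nat \<Rightarrow> int fps" where
  "shanks_term s = (if s = 0 then 1 else overpartitions_upto_fps s + overpartitions_upto_fps (s - 1))"

lemma shanks_term_Suc:
  "(1 - fps_X ^ Suc s) * shanks_term (Suc s) = 2 * overpartitions_upto_fps s"
  "(1 + fps_X ^ Suc s) * shanks_term (Suc s) = 2 * overpartitions_upto_fps (Suc s)"
  using overpartitions_upto_fps_Suc[of s] by (simp_all add: shanks_term_def algebra_simps)

text \<open>
  The left side compares the right sides of the finite identity for \<open>n\<close> and \<open>n - 1\<close>. By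
  \<open>shanks_term_Suc\<close>, each summand contributes the difference of two consecutive values of
  the right side.
\<close>

lemma shanks_telescope:
  "(1 - fps_X ^ n) * (\<Sum>s\<le>m. (-1) ^ s * fps_X ^ (s * Suc n) * shanks_term s)
   - (1 + fps_X ^ n) * (\<Sum>s\<le>m. (-1) ^ s * fps_X ^ (s * n) * shanks_term s)
   = 2 * (-1) ^ Suc m * fps_X ^ (Suc m * n) * overpartitions_upto_fps m"
proof (induction m)
  case 0
  show ?case by (simp add: shanks_term_def overpartition_fps_empty)
next
  case (Suc m)
  define q t y v :: "int fps" where "q = fps_X ^ n" and "t = fps_X ^ Suc m"
    and "y = (-1) ^ Suc m * fps_X ^ (Suc m * n)" and "v = shanks_term (Suc m)"
  have v: "(1 - t) * v = 2 * overpartitions_upto_fps m"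
    "(1 + t) * v = 2 * overpartitions_upto_fps (Suc m)"
    unfolding t_def v_def by (rule shanks_term_Suc)+
  have exps: "(-1) ^ Suc m * fps_X ^ (Suc m * Suc n) = y * t"
    "2 * (-1) ^ Suc (Suc m) * fps_X ^ (Suc (Suc m) * n) = - 2 * (y * q)"
    unfolding y_def t_def q_def by (simp_all add: power_add algebra_simps)
  have "(1 - q) * (y * t * v) - (1 + q) * (y * v) = - (y * ((1 - t) * v)) - y * q * ((1 + t) * v)"
    by (simp add: algebra_simps)
  also have "\<dots> = - (2 * y * overpartitions_upto_fps m) - 2 * (y * q) * overpartitions_upto_fps (Suc m)"
    unfolding v by (simp add: algebra_simps)
  finally have step: "(1 - q) * (y * t * v) - (1 + q) * (y * v) = \<dots>" .
  define S T where "S = (\<Sum>s\<le>m. (-1) ^ s * fps_X ^ (s * Suc n) * shanks_term s)"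
    and "T = (\<Sum>s\<le>m. (-1) ^ s * fps_X ^ (s * n) * shanks_term s)"
  have IH: "(1 - q) * S - (1 + q) * T = 2 * y * overpartitions_upto_fps m"
    using Suc.IH by (simp only: S_def T_def q_def y_def mult.assoc)
  have "(1 - q) * (S + y * t * v) - (1 + q) * (T + y * v) = - 2 * (y * q) * overpartitions_upto_fps (Suc m)"
  proof -
    have "(1 - q) * (S + y * t * v) - (1 + q) * (T + y * v)
       = ((1 - q) * S - (1 + q) * T) + ((1 - q) * (y * t * v) - (1 + q) * (y * v))"
      by (simp add: algebra_simps)
    also have "\<dots> = - 2 * (y * q) * overpartitions_upto_fps (Suc m)"
      unfolding IH step by simp
    finally show ?thesis .
  qed
  then show ?case
    unfolding sum.atMost_Suc exps S_def[symmetric] T_def[symmetric] y_def[symmetric] v_def[symmetric] q_def[symmetric] .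
qed

text \<open>
  Passing from \<open>k\<close> to \<open>k + 1\<close> multiplies the product by \<open>(1 + q) / (1 - q)\<close>, where \<open>q\<close> stands for
  \<open>fps_X ^ Suc k\<close>; after clearing the denominator, the telescoping sum accounts exactly for the new
  square.
\<close>

lemma shanks_identity:
  "(1 + 2 * (\<Sum>s=1..n. (-1) ^ s * fps_X ^ (s\<^sup>2))) * overpartitions_upto_fps n
   = (\<Sum>s\<le>n. (-1) ^ s * fps_X ^ (s * Suc n) * shanks_term s)"
proof (induction n)
  case 0
  show ?case by (simp add: shanks_term_def overpartition_fps_empty)
next
  case (Suc k)
  define q y a S T :: "int fps" where "q = fps_X ^ Suc k" and "y = (-1) ^ Suc k * fps_X ^ (Suc k * Suc k)"
    and "a = 1 + 2 * (\<Sum>s=1..k. (-1) ^ s * fps_X ^ (s\<^sup>2))"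
    and "S = (\<Sum>s\<le>k. (-1) ^ s * fps_X ^ (s * Suc k) * shanks_term s)"
    and "T = (\<Sum>s\<le>k. (-1) ^ s * fps_X ^ (s * Suc (Suc k)) * shanks_term s)"
  have IH: "a * overpartitions_upto_fps k = S" using Suc.IH by (simp add: a_def S_def)
  have lhs: "1 + 2 * (\<Sum>s=1..Suc k. (-1) ^ s * fps_X ^ (s\<^sup>2)) = a + 2 * y"
    by (simp add: a_def y_def power2_eq_square distrib_left)
  have rhs: "(\<Sum>s\<le>Suc k. (-1) ^ s * fps_X ^ (s * Suc (Suc k)) * shanks_term s)
      = T + y * q * shanks_term (Suc k)"
    by (simp add: T_def y_def q_def power_add algebra_simps)
  have tel: "(1 - q) * T - (1 + q) * S = 2 * y * overpartitions_upto_fps k"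
    using shanks_telescope[of "Suc k" k] by (simp add: T_def S_def q_def y_def)
  have O: "(1 - q) * overpartitions_upto_fps (Suc k) = (1 + q) * overpartitions_upto_fps k"
    and v: "(1 - q) * shanks_term (Suc k) = 2 * overpartitions_upto_fps k"
    unfolding q_def by (rule overpartitions_upto_fps_Suc shanks_term_Suc)+
  have "(1 - q) * ((a + 2 * y) * overpartitions_upto_fps (Suc k))
      = (a + 2 * y) * ((1 - q) * overpartitions_upto_fps (Suc k))"
    by (simp only: mult_ac)
  also have "\<dots> = (1 + q) * (a * overpartitions_upto_fps k)
      + 2 * y * overpartitions_upto_fps k + y * q * (2 * overpartitions_upto_fps k)"
    unfolding O by (simp add: algebra_simps)
  also have "\<dots> = (1 - q) * T + y * q * ((1 - q) * shanks_term (Suc k))"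
    unfolding IH v tel[symmetric] by simp
  also have "\<dots> = (1 - q) * (T + y * q * shanks_term (Suc k))"
    by (simp only: distrib_left mult_ac)
  finally have "(1 - q) * ((a + 2 * y) * overpartitions_upto_fps (Suc k)) = \<dots>" .
  moreover have "1 - q \<noteq> 0"
    unfolding q_def by (rule fps_nonzeroI[of _ 0]) simp
  ultimately show ?case unfolding lhs rhs by simp
qed

definition theta_fps :: "int fps" where
  "theta_fps = Abs_fps (\<lambda>n. if n = 0 then 1 else if is_square n then 2 else 0)"

text \<open>
  The reflected theta series is the sum of \<open>(-1)^s q^(s^2)\<close> over all integers \<open>s\<close>, because \<open>s\<close> and
  \<open>s^2\<close> have the same parity.
\<close>

lemma theta_fps_truncate:
  assumes "j \<le> n"
  shows "reflect theta_fps $ j = (1 + 2 * (\<Sum>s=1..n. (-1) ^ s * fps_X ^ (s\<^sup>2))) $ j"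
proof -
  have sgn: "((-1) ^ s * fps_X ^ m :: int fps) $ j = (if j = m then (-1) ^ s else 0)" for s m
    by (cases "even s") auto
  note nth = fps_numeral_mult_nth
  have rhs: "(1 + 2 * (\<Sum>s=1..n. (-1) ^ s * fps_X ^ (s\<^sup>2)) :: int fps) $ j
      = (if j = 0 then 1 else 0) + 2 * (\<Sum>s=1..n. if j = s\<^sup>2 then (-1) ^ s else 0)"
    by (simp add: nth fps_sum_nth sgn)
  show ?thesis
  proof (cases "j > 0 \<and> is_square j")
    case True
    then obtain t where t: "j = t\<^sup>2" "t > 0" by (auto simp: is_nth_power_def)
    have "t \<le> n" using assms t by (metis order_trans power2_nat_le_imp_le le_refl)
    then have "(\<Sum>s=1..n. if j = s\<^sup>2 then (-1) ^ s else 0 :: int) = (\<Sum>s=1..n. if s = t then (-1) ^ t else 0)"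
      using t by (intro sum.cong) auto
    also have "\<dots> = (-1) ^ t" using t \<open>t \<le> n\<close> by simp
    finally show ?thesis
      unfolding rhs using t True by (simp add: reflect_nth theta_fps_def) (simp add: minus_one_power_iff)
  next
    case False
    then have "(\<Sum>s=1..n. if j = s\<^sup>2 then (-1) ^ s else 0 :: int) = 0"
      by (intro sum.neutral) (auto simp: is_nth_power_def)
    with False show ?thesis unfolding rhs by (auto simp: reflect_nth theta_fps_def)
  qed
qed

text \<open>
  On the right side of the finite identity all terms with \<open>s > 0\<close> start beyond \<open>q^n\<close>.
\<close>

theorem gauss_identity: "overpartition_fps UNIV * reflect theta_fps = 1"
proof (rule fps_ext)
  fix n
  let ?a = "1 + 2 * (\<Sum>s=1..n. (-1) ^ s * fps_X ^ (s\<^sup>2)) :: int fps"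
  have "(overpartition_fps UNIV * reflect theta_fps) $ n = (overpartitions_upto_fps n * ?a) $ n"
    unfolding fps_mult_nth
    by (intro sum.cong refl arg_cong2[where f = "(*)"] overpartition_fps_nth_cong theta_fps_truncate) auto
  also have "overpartitions_upto_fps n * ?a = (\<Sum>s\<le>n. (-1) ^ s * fps_X ^ (s * Suc n) * shanks_term s)"
    using shanks_identity[of n] by (simp only: mult.commute)
  also have "\<dots> $ n = (\<Sum>s\<le>n. if s = 0 then 1 $ n else 0)"
  proof (subst fps_sum_nth, intro sum.cong refl)
    fix s
    have "((-1) ^ s * fps_X ^ (s * Suc n) * shanks_term s) $ n
       = (fps_X ^ (s * Suc n) * ((-1) ^ s * shanks_term s)) $ n"
      by (simp only: mult_ac)
    moreover have "n < s * Suc n" if "s > 0" using that by (cases s) auto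
    ultimately show "((-1) ^ s * fps_X ^ (s * Suc n) * shanks_term s) $ n = (if s = 0 then 1 $ n else 0)"
      by (cases "s = 0") (simp_all add: fps_X_power_mult_nth shanks_term_def del: mult_Suc_right)
  qed
  also have "\<dots> = 1 $ n" by simp
  finally show "(overpartition_fps UNIV * reflect theta_fps) $ n = 1 $ n" .
qed

section \<open>The generating function of the odd minus even part sums\<close>

text \<open>
  An odd part \<open>m\<close> contributes the factor \<open>(1 + q^m) / (1 - q^m)\<close>, which becomes its own inverse
  under \<open>q \<mapsto> -q\<close>.
\<close>

lemma overpartition_fps_finite_odd_reflect:
  assumes "finite A" "\<forall>m\<in>A. odd m"
  shows "overpartition_fps A * reflect (overpartition_fps A) = 1"
  using assms
proof (induction A rule: finite_induct)
  case empty
  show ?case unfolding overpartition_fps_empty by simp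
next
  case (insert m A)
  define F G where "F = overpartition_fps (insert m A)" and "G = overpartition_fps A"
  define x y :: "int fps" where "x = 1 - fps_X ^ m" and "y = 1 + fps_X ^ m"
  have m: "m > 0" "odd m" using insert.prems odd_pos by auto
  have nz: "x \<noteq> 0" "y \<noteq> 0"
    unfolding x_def y_def using m by - (rule fps_nonzeroI[of _ 0], simp)+
  have "reflect (fps_X ^ m) = - (fps_X ^ m)"
    using m(2) by (intro fps_ext) (auto simp: reflect_nth)
  then have swap: "reflect x = y" "reflect y = x"
    unfolding x_def y_def by (simp_all only: fps_compose_add_distrib fps_compose_sub_distrib fps_compose_1) simp_all
  have step: "x * F = y * G"
    unfolding x_def y_def F_def G_def using overpartition_fps_insert m(1) insert.hyps(2) by blast
  have step': "y * reflect F = x * reflect G"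
    using arg_cong[OF step, of reflect] unfolding reflect_mult swap .
  have "(x * y) * (F * reflect F) = (x * F) * (y * reflect F)"
    by (simp only: mult_ac)
  also have "\<dots> = (x * y) * (G * reflect G)"
    unfolding step step' by (simp only: mult_ac)
  also have "G * reflect G = 1"
    unfolding G_def using insert by blast
  finally have "F * reflect F = 1"
    using nz by simp
  then show ?case unfolding F_def .
qed

lemma overpartition_fps_odd_reflect:
  "overpartition_fps {m. odd m} * reflect (overpartition_fps {m. odd m}) = 1"
proof (rule fps_ext)
  fix n :: nat
  let ?A = "{m. odd m} \<inter> {1..n}"
  have nth: "overpartition_fps {m. odd m} $ i = overpartition_fps ?A $ i" if "i \<le> n" for i
    using that by (intro overpartition_fps_nth_cong) auto
  have "(overpartition_fps {m. odd m} * reflect (overpartition_fps {m. odd m})) $ n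
     = (overpartition_fps ?A * reflect (overpartition_fps ?A)) $ n"
    unfolding fps_mult_nth reflect_nth by (intro sum.cong) (simp_all add: nth)
  also have "\<dots> = 1 $ n"
    by (subst overpartition_fps_finite_odd_reflect) auto
  finally show "(overpartition_fps {m. odd m} * reflect (overpartition_fps {m. odd m})) $ n = 1 $ n" .
qed

abbreviation opf :: "int fps" where "opf \<equiv> overpartition_fps UNIV"

lemma opf_odd_even: "opf = overpartition_fps {m. odd m} * dilate 2 opf"
proof -
  have un: "{m. odd m} \<union> {m::nat. even m} = UNIV" and disj: "{m. odd m} \<inter> {m::nat. even m} = {}"
    by auto
  show ?thesis
    using overpartition_fps_Un[OF disj] unfolding un overpartition_fps_even .
qed

text \<open>
  Reflecting \<open>P = P1 P2\<close> changes \<open>P1\<close> into its inverse and leaves the even series \<open>P2\<close> alone, while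
  by Gauss the reflection of \<open>P\<close> is the inverse of the theta series. Hence \<open>P2 \<theta> = P1\<close>.
\<close>

lemma overpartition_fps_odd: "overpartition_fps {m. odd m} = theta_fps * dilate 2 opf"
proof -
  have "reflect opf * theta_fps = 1"
    using arg_cong[OF gauss_identity, of reflect] by (simp add: reflect_mult reflect_reflect)
  moreover have "reflect opf =
      reflect (overpartition_fps {m. odd m}) * dilate 2 opf"
    by (subst opf_odd_even) (simp add: reflect_mult reflect_dilate_even)
  ultimately have "reflect (overpartition_fps {m. odd m}) * (theta_fps * dilate 2 opf) = 1"
    by (simp add: mult_ac)
  then have "overpartition_fps {m. odd m} * (reflect (overpartition_fps {m. odd m}) * (theta_fps * dilate 2 opf))
    = overpartition_fps {m. odd m}"
    by simp
  then show ?thesis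
    unfolding mult.assoc[symmetric] overpartition_fps_odd_reflect by simp
qed

lemma opf_eq: "opf = theta_fps * dilate 2 opf ^ 2"
  by (subst opf_odd_even) (simp add: overpartition_fps_odd power2_eq_square mult.assoc)

definition square_fps :: "int fps" where
  "square_fps = Abs_fps (\<lambda>n. if is_square n then int n else 0)"

text \<open>
  With \<open>P1 = \<theta> P2\<close> the product rule makes the terms with the derivative of \<open>P2\<close> cancel.
\<close>

lemma SOME_overline_fps: "Abs_fps SOME_overline = 2 * square_fps * dilate 2 opf ^ 2"
proof -
  have "fps_XD theta_fps = 2 * square_fps"
    by (rule fps_ext) (auto simp: fps_XD_nth theta_fps_def square_fps_def fps_numeral_mult_nth)
  moreover have "Abs_fps SOME_overline = fps_XD theta_fps * dilate 2 opf ^ 2"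
    unfolding fps_eq_iff
    by (simp add: SOME_overline_eq overpartition_fps_even overpartition_fps_odd fps_XD_mult
        power2_eq_square algebra_simps)
  ultimately show ?thesis by simp
qed

text \<open>
  Both sides are the inverse of \<open>P(q^2)^2\<close>: the left one because \<open>P(q) \<theta>(-q) = 1\<close> and
  \<open>P = \<theta> P(q^2)^2\<close>, the right one by Gauss's identity at \<open>q^2\<close>.
\<close>

lemma theta_fps_mult_reflect: "theta_fps * reflect theta_fps = dilate 2 (reflect theta_fps ^ 2)"
proof -
  have "dilate 2 opf * dilate 2 (reflect theta_fps) = 1"
    using arg_cong[OF gauss_identity, of "dilate 2"] by (simp add: dilate_mult)
  then have "(dilate 2 opf * dilate 2 (reflect theta_fps)) ^ 2 = 1"
    by simp
  then have "theta_fps * reflect theta_fps = theta_fps * reflect theta_fps *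
      (dilate 2 opf * dilate 2 (reflect theta_fps)) ^ 2"
    by simp
  also have "\<dots> = (theta_fps * dilate 2 opf ^ 2 * reflect theta_fps) * dilate 2 (reflect theta_fps) ^ 2"
    by (simp only: power_mult_distrib mult_ac)
  also have "theta_fps * dilate 2 opf ^ 2 * reflect theta_fps = 1"
    using gauss_identity by (simp only: opf_eq[symmetric])
  finally show ?thesis by (simp add: dilate_power)
qed

section \<open>Dissection by residue classes of the exponent\<close>

text \<open>
  For fixed \<open>M\<close> this is the grading of power series by the integers modulo \<open>M\<close>: exponents
  of products add up.
\<close>

definition graded :: "nat \<Rightarrow> nat \<Rightarrow> int fps \<Rightarrow> bool" where
  "graded M r f \<longleftrightarrow> (\<forall>n. f $ n \<noteq> 0 \<longrightarrow> [n = r] (mod M))"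

lemma graded_mult:
  assumes "graded M r f" "graded M s g"
  shows "graded M (r + s) (f * g)"
  unfolding graded_def
proof (intro allI impI)
  fix n assume "(f * g) $ n \<noteq> 0"
  then obtain i where i: "i \<le> n" "f $ i * g $ (n - i) \<noteq> 0"
    unfolding fps_mult_nth by (meson atLeastAtMost_iff sum.not_neutral_contains_not_neutral)
  then have "[i + (n - i) = r + s] (mod M)"
    using assms by (intro cong_add) (auto simp: graded_def)
  with i(1) show "[n = r + s] (mod M)" by simp
qed

lemma graded_power: "graded M r f \<Longrightarrow> graded M (k * r) (f ^ k)"
proof (induction k)
  case 0
  show ?case by (simp add: graded_def)
next
  case (Suc k)
  then show ?case using graded_mult[of M r f "k * r" "f ^ k"] by simp
qed

lemma graded_dilate: "k > 0 \<Longrightarrow> M dvd k \<Longrightarrow> graded M 0 (dilate k f)"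
  by (auto simp: graded_def dilate_nth cong_0_iff)

lemma graded_nth_eq_0: "graded M r f \<Longrightarrow> \<not> [n = r] (mod M) \<Longrightarrow> f $ n = 0"
  by (auto simp: graded_def)

definition odd_theta_fps :: "int fps" where
  "odd_theta_fps = Abs_fps (\<lambda>n. if odd n \<and> is_square n then 1 else 0)"

definition odd_square_fps :: "int fps" where
  "odd_square_fps = Abs_fps (\<lambda>n. if odd n \<and> is_square n then int n else 0)"

lemma even_square_iff:
  fixes n :: nat
  assumes "even n"
  shows "is_square n \<longleftrightarrow> 4 dvd n \<and> is_square (n div 4)"
proof
  assume "is_square n"
  then obtain t where t: "n = t\<^sup>2" by (auto simp: is_nth_power_def)
  with assms obtain u where "t = 2 * u" by (auto elim: evenE)
  with t have "n = 4 * u\<^sup>2" by (simp add: power_mult_distrib)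
  then show "4 dvd n \<and> is_square (n div 4)" by (simp add: is_nth_power_def)
next
  assume "4 dvd n \<and> is_square (n div 4)"
  then obtain u where "n = 4 * u\<^sup>2" by (auto simp: is_nth_power_def elim!: dvdE)
  then have "n = (2 * u)\<^sup>2" by (simp add: power_mult_distrib)
  then show "is_square n" by (rule is_nth_powerI)
qed

lemma odd_square_mod_8:
  fixes n :: nat
  assumes "odd n" "is_square n"
  shows "[n = 1] (mod 8)"
proof -
  obtain t where t: "n = t\<^sup>2" using assms by (auto simp: is_nth_power_def)
  with assms have "odd t" by simp
  then have "t mod 8 = 1 \<or> t mod 8 = 3 \<or> t mod 8 = 5 \<or> t mod 8 = 7" by presburger
  then have "(t mod 8)\<^sup>2 mod 8 = 1" by auto
  then show ?thesis by (simp add: t cong_def power_mod)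
qed

lemma theta_fps_split: "theta_fps = dilate 4 theta_fps + 2 * odd_theta_fps"
proof (rule fps_ext)
  fix n :: nat
  have "even n" if "4 dvd n" using that by presburger
  then show "theta_fps $ n = (dilate 4 theta_fps + 2 * odd_theta_fps) $ n"
    using even_square_iff[of n]
    by (auto simp: fps_numeral_mult_nth dilate_nth theta_fps_def odd_theta_fps_def elim!: dvdE)
qed

lemma square_fps_split: "square_fps = odd_square_fps + 4 * dilate 4 square_fps"
proof (rule fps_ext)
  fix n :: nat
  have "even n" if "4 dvd n" using that by presburger
  then show "square_fps $ n = (odd_square_fps + 4 * dilate 4 square_fps) $ n"
    using even_square_iff[of n]
    by (auto simp: fps_numeral_mult_nth dilate_nth square_fps_def odd_square_fps_def elim!: dvdE)
qed

lemma graded_odd_theta: "graded 8 1 odd_theta_fps"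
  by (auto simp: graded_def odd_theta_fps_def split: if_splits dest: odd_square_mod_8)

lemma graded_mono: "graded M r f \<Longrightarrow> K dvd M \<Longrightarrow> graded K r f"
  by (auto simp: graded_def intro: cong_dvd_modulus_nat)

lemma graded_odd_theta_4: "graded 4 1 odd_theta_fps"
  by (rule graded_mono[OF graded_odd_theta]) simp

lemma graded_odd_square: "graded 4 1 odd_square_fps"
proof -
  have "graded 8 1 odd_square_fps"
    by (auto simp: graded_def odd_square_fps_def split: if_splits dest: odd_square_mod_8)
  then show ?thesis by (rule graded_mono) simp
qed

text \<open>
  From \<open>\<theta>(q) \<theta>(-q) = (a + 2 b) (a - 2 b) = a^2 - 4 b^2\<close> one knows \<open>\<theta>(-q^2)^2\<close>. Replacing \<open>q^2\<close> by
  \<open>-q^2\<close> changes the sign of the exponents that are 2 modulo 4, and these are precisely the ones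
  that come from \<open>b^2\<close>.
\<close>

lemma dilate_theta_sq:
  "dilate 2 theta_fps ^ 2 = dilate 4 theta_fps ^ 2 + 4 * odd_theta_fps ^ 2"
proof (rule fps_ext)
  fix n
  define a b where "a = dilate 4 theta_fps" and "b = odd_theta_fps"
  have g: "graded 4 0 (a ^ 2)" "graded 4 2 (b ^ 2)"
    using graded_power[OF graded_dilate[of 4 4 theta_fps], of 2]
      graded_power[OF graded_odd_theta_4, of 2] by (simp_all add: a_def b_def)
  have "reflect a = a" unfolding a_def by (rule reflect_dilate_even) simp_all
  moreover have "reflect b = - b" unfolding b_def
    by (rule fps_ext) (auto simp: reflect_nth odd_theta_fps_def)
  ultimately have "reflect theta_fps = a - 2 * b"
    by (subst theta_fps_split)
      (simp add: fps_compose_add_distrib reflect_mult flip: a_def b_def)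
  moreover have "theta_fps = a + 2 * b" unfolding a_def b_def by (rule theta_fps_split)
  ultimately have "theta_fps * reflect theta_fps = (a + 2 * b) * (a - 2 * b)" by (simp only:)
  then have key: "dilate 2 (reflect (theta_fps ^ 2)) = a ^ 2 - 4 * b ^ 2"
    unfolding theta_fps_mult_reflect reflect_power by (simp add: power2_eq_square algebra_simps)
  have "dilate 2 (theta_fps ^ 2) $ n = (a ^ 2 + 4 * b ^ 2) $ n"
  proof (cases "even n")
    case False
    then have "\<not> [n = 0] (mod 4)" "\<not> [n = 2] (mod 4)"
      unfolding cong_def by presburger+
    with False g show ?thesis by (simp add: dilate_nth fps_numeral_mult_nth graded_nth_eq_0)
  next
    case True
    then obtain m where m: "n = 2 * m" by (elim evenE)
    have k: "(-1) ^ m * (theta_fps ^ 2) $ m = (a ^ 2) $ n - 4 * (b ^ 2) $ n"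
      using arg_cong[OF key, of "\<lambda>f. f $ n"]
      by (simp add: m dilate_nth reflect_nth fps_numeral_mult_nth)
    show ?thesis
    proof (cases "even m")
      case True
      then have "\<not> [n = 2] (mod 4)" unfolding cong_def m by presburger
      then have "(b ^ 2) $ n = 0" using g graded_nth_eq_0 by blast
      with k True show ?thesis by (simp add: m dilate_nth fps_numeral_mult_nth)
    next
      case False
      then have "\<not> [n = 0] (mod 4)" unfolding cong_def m by presburger
      then have "(a ^ 2) $ n = 0" using g graded_nth_eq_0 by blast
      with k False show ?thesis by (simp add: m dilate_nth fps_numeral_mult_nth)
    qed
  qed
  then show "(dilate 2 theta_fps ^ 2) $ n = (dilate 4 theta_fps ^ 2 + 4 * odd_theta_fps ^ 2) $ n"
    by (simp add: dilate_power a_def b_def)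
qed

lemma dilate_2_opf: "dilate 2 opf = dilate 2 theta_fps * dilate 4 opf ^ 2"
  by (subst opf_eq) (simp add: dilate_mult dilate_power dilate_dilate)

lemma numeral_dvd_nth: "numeral w dvd f \<Longrightarrow> (numeral w :: int) dvd f $ n"
  by (auto simp: fps_numeral_mult_nth elim!: dvdE)

lemma SOME_overline_nth: "SOME_overline n = 2 * (square_fps * dilate 2 opf ^ 2) $ n"
  using arg_cong[OF SOME_overline_fps, of "\<lambda>f. f $ n"]
  by (simp add: mult.assoc fps_numeral_mult_nth)

text \<open>
  In \<open>W P(q^2)^2 = (V + 4 W(q^4)) (a^2 + 4 b^2) P(q^4)^4\<close> the four products have exponents
  congruent to 1, 3, 0 and 2 modulo 4, so only \<open>4 W(q^4) a^2 P(q^4)^4\<close> matters.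
\<close>

lemma SOME_overline_4:
  "SOME_overline (4 * n) = 8 * (square_fps * theta_fps ^ 2 * opf ^ 4) $ n"
proof -
  define a b p v w where "a = dilate 4 theta_fps" and "b = odd_theta_fps" and "p = dilate 4 opf"
    and "v = odd_square_fps" and "w = dilate 4 square_fps"
  have ga: "graded 4 0 (a ^ k)" and gp: "graded 4 0 (p ^ k)" and gw: "graded 4 0 w"
    and gb: "graded 4 k (b ^ k)" and gv: "graded 4 1 v" for k
    using graded_power[OF graded_dilate[of 4 4 theta_fps], of k]
      graded_power[OF graded_dilate[of 4 4 opf], of k] graded_dilate[of 4 4 square_fps]
      graded_power[OF graded_odd_theta_4, of k] graded_odd_square
    by (simp_all add: a_def b_def p_def v_def w_def)
  have "square_fps * dilate 2 opf ^ 2 = (v + 4 * w) * ((a ^ 2 + 4 * b ^ 2) * p ^ 4)"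
    unfolding dilate_2_opf power_mult_distrib dilate_theta_sq
    by (subst square_fps_split) (simp add: a_def b_def p_def v_def w_def flip: power_mult)
  also have "\<dots> = v * a ^ 2 * p ^ 4 + 4 * (v * b ^ 2 * p ^ 4) + 4 * (w * a ^ 2 * p ^ 4)
      + 16 * (w * b ^ 2 * p ^ 4)"
    by (simp add: algebra_simps)
  finally have eq: "square_fps * dilate 2 opf ^ 2 = \<dots>" .
  have "(v * a ^ 2 * p ^ 4) $ (4 * n) = 0"
    using graded_mult[OF graded_mult[OF gv ga[of 2]] gp[of 4]]
    by (rule graded_nth_eq_0) (simp add: cong_def mod_simps)
  moreover have "(v * b ^ 2 * p ^ 4) $ (4 * n) = 0"
    using graded_mult[OF graded_mult[OF gv gb[of 2]] gp[of 4]]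
    by (rule graded_nth_eq_0) (simp add: cong_def mod_simps)
  moreover have "(w * b ^ 2 * p ^ 4) $ (4 * n) = 0"
    using graded_mult[OF graded_mult[OF gw gb[of 2]] gp[of 4]]
    by (rule graded_nth_eq_0) (simp add: cong_def mod_simps)
  moreover have "w * a ^ 2 * p ^ 4 = dilate 4 (square_fps * theta_fps ^ 2 * opf ^ 4)"
    by (simp add: w_def a_def p_def dilate_mult dilate_power)
  ultimately have "(square_fps * dilate 2 opf ^ 2) $ (4 * n)
      = 4 * (square_fps * theta_fps ^ 2 * opf ^ 4) $ n"
    unfolding eq by (simp add: fps_numeral_mult_nth dilate_nth)
  then show ?thesis by (simp add: SOME_overline_nth)
qed

section \<open>Congruences for the coefficients\<close>

lemma dvd_power_minus_1: "z dvd y - 1 \<Longrightarrow> z dvd y ^ k - (1 :: 'a :: comm_ring_1)"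
  using power_diff_1_eq[of y k] by (metis dvd_mult2)

text \<open>
  Both factors of \<open>f^2 - 1 = (f - 1) (f + 1)\<close> are even, and every further squaring of \<open>f^2\<close>
  contributes one more even factor of this kind.
\<close>

lemma even_power_dvd:
  fixes f :: "int fps"
  assumes "2 dvd f - 1"
  shows "4 dvd f ^ (2 * k) - 1" "16 dvd f ^ 16 - 1"
proof -
  obtain g where g: "f = 1 + 2 * g" using assms by (metis dvdE diff_add_cancel add.commute)
  have sq: "f ^ 2 - 1 = 4 * (g * (1 + g))" unfolding g by (simp add: power2_eq_square algebra_simps)
  show "4 dvd f ^ (2 * k) - 1"
    unfolding power_mult by (rule dvd_power_minus_1) (simp add: sq)
  have two: "2 dvd f ^ k + 1" for k
  proof -
    have "2 dvd (f ^ k - 1) + 2" using dvd_power_minus_1[OF assms, of k] by (rule dvd_add) simp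
    then show ?thesis by (simp add: algebra_simps)
  qed
  have "f ^ 16 - 1 = (f ^ 4 + 1) * (f ^ 8 + 1) * ((f ^ 2 - 1) * (f ^ 2 + 1))"
    by (simp add: power_numeral_reduce algebra_simps)
  moreover have "2 * 2 * (4 * 1) dvd (f ^ 4 + 1) * (f ^ 8 + 1) * ((f ^ 2 - 1) * (f ^ 2 + 1))"
    by (intro mult_dvd_mono two one_dvd) (simp add: sq)
  ultimately show "16 dvd f ^ 16 - 1" by simp
qed

lemma opf_cong_1: "2 dvd opf - 1"
proof -
  have "even ((opf - 1) $ n)" for n
  proof (cases "n = 0")
    case True
    have "partitions_in UNIV 0 = {{#}}" by (auto simp: partitions_in_def partitions_def) (metis multiset_nonemptyE)
    with True show ?thesis by (simp add: overpartition_fps_def)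
  next
    case False
    have "even (2 ^ card (set_mset P) :: int)" if "P \<in> partitions_in UNIV n" for P
      using that False by (auto simp: partitions_in_def partitions_def card_gt_0_iff)
    with False show ?thesis by (simp add: overpartition_fps_def dvd_sum)
  qed
  then have "opf - 1 = 2 * Abs_fps (\<lambda>n. (opf - 1) $ n div 2)"
    by (intro fps_ext) (simp add: fps_numeral_mult_nth)
  then show ?thesis by (rule dvdI)
qed

lemma theta_cong_1: "2 dvd theta_fps - 1"
proof -
  have "theta_fps - 1 = 2 * Abs_fps (\<lambda>n. if n > 0 \<and> is_square n then 1 else 0)"
    by (intro fps_ext) (simp add: fps_numeral_mult_nth theta_fps_def)
  then show ?thesis by (rule dvdI)
qed

text \<open>
  This is where the nonsquare enters: a cofactor of \<open>W\<close> that is 1 modulo \<open>w\<close> may be replaced by 1,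
  and \<open>W\<close> itself has coefficient 0 at \<open>n\<close>.
\<close>

lemma square_fps_mult_nth_dvd:
  assumes "\<not> is_square n" "numeral w dvd g - 1"
  shows "(numeral w :: int) dvd (square_fps * g) $ n"
proof -
  have "square_fps $ n = 0" using assms(1) by (simp add: square_fps_def)
  moreover have "numeral w dvd square_fps * (g - 1)" using assms(2) by simp
  then have "(numeral w :: int) dvd (square_fps * (g - 1)) $ n" by (rule numeral_dvd_nth)
  ultimately show ?thesis by (simp add: right_diff_distrib)
qed

lemma theta_opf_cong_1: "2 dvd theta_fps ^ i * opf ^ j - 1"
proof -
  have "2 dvd (theta_fps ^ i - 1) * opf ^ j + (opf ^ j - 1)"
    by (intro dvd_add dvd_mult2 dvd_power_minus_1 theta_cong_1 opf_cong_1)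
  then show ?thesis by (simp add: algebra_simps)
qed

lemma odd_square_cong_odd_theta: "2 dvd odd_square_fps - odd_theta_fps"
proof -
  have "odd_square_fps - odd_theta_fps
      = 2 * Abs_fps (\<lambda>n. if odd n \<and> is_square n then int (n div 2) else 0)"
    by (intro fps_ext) (auto simp: fps_numeral_mult_nth odd_square_fps_def odd_theta_fps_def elim!: oddE)
  then show ?thesis by (rule dvdI)
qed

text \<open>
  This is \<open>\<theta>^6 \<theta>(q^2)^8\<close> in terms of \<open>a\<close> and \<open>b\<close>. The power \<open>b^i\<close> always comes with \<open>2^i\<close>, so
  everything from \<open>b^6\<close> on is divisible by 64.
\<close>

lemma expand_mod_64:
  fixes a b :: "'a :: comm_ring_1"
  shows "\<exists>R. (a + 2 * b) ^ 6 * (a ^ 2 + 4 * b ^ 2) ^ 4 = a ^ 14 + 12 * (a ^ 13 * b)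
    + 76 * (a ^ 12 * b ^ 2) + 352 * (a ^ 11 * b ^ 3) + 1296 * (a ^ 10 * b ^ 4)
    + 3904 * (a ^ 9 * b ^ 5) + 64 * R"
proof
  have e6: "(a + 2 * b) ^ 6 = a ^ 6 + 12 * a ^ 5 * b + 60 * a ^ 4 * b ^ 2 + 160 * a ^ 3 * b ^ 3
      + 240 * a ^ 2 * b ^ 4 + 192 * a * b ^ 5 + 64 * b ^ 6"
    by (simp add: power_numeral_reduce algebra_simps)
  have e4: "(a ^ 2 + 4 * b ^ 2) ^ 4 = a ^ 8 + 16 * a ^ 6 * b ^ 2 + 96 * a ^ 4 * b ^ 4
      + 256 * a ^ 2 * b ^ 6 + 256 * b ^ 8"
    by (simp add: power_numeral_reduce algebra_simps)
  show "(a + 2 * b) ^ 6 * (a ^ 2 + 4 * b ^ 2) ^ 4 = a ^ 14 + 12 * (a ^ 13 * b)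
    + 76 * (a ^ 12 * b ^ 2) + 352 * (a ^ 11 * b ^ 3) + 1296 * (a ^ 10 * b ^ 4)
    + 3904 * (a ^ 9 * b ^ 5)
    + 64 * (155 * a ^ 8 * b ^ 6 + 336 * a ^ 7 * b ^ 7 + 620 * a ^ 6 * b ^ 8 + 976 * a ^ 5 * b ^ 9
      + 1296 * a ^ 4 * b ^ 10 + 1408 * a ^ 3 * b ^ 11 + 1216 * a ^ 2 * b ^ 12 + 768 * a * b ^ 13
      + 256 * b ^ 14)"
    unfolding e6 e4 by (simp add: power_numeral_reduce algebra_simps)
qed

text \<open>
  Here divisibility by 16 sets in at \<open>b^3\<close> already, because 14 choose 3 is even.
\<close>

lemma expand_mod_16:
  fixes a b :: "'a :: comm_ring_1"
  shows "\<exists>R. (a + 2 * b) ^ 14 = a ^ 14 + 28 * (a ^ 13 * b) + 364 * (a ^ 12 * b ^ 2) + 16 * R"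
proof
  define r where "r = 35 * a ^ 4 * b ^ 3 + 70 * a ^ 3 * b ^ 4 + 84 * a ^ 2 * b ^ 5 + 56 * a * b ^ 6
    + 16 * b ^ 7"
  define c where "c = a ^ 7 + 14 * (a ^ 6 * b) + 84 * (a ^ 5 * b ^ 2)"
  have "(a + 2 * b) ^ 7 = c + 8 * r"
    unfolding r_def c_def by (simp add: power_numeral_reduce algebra_simps)
  moreover have "(a + 2 * b) ^ 14 = ((a + 2 * b) ^ 7) ^ 2"
    by (simp flip: power_mult)
  ultimately have "(a + 2 * b) ^ 14 = c ^ 2 + 16 * (c * r + 4 * r ^ 2)"
    by (simp add: power2_eq_square algebra_simps)
  also have "c ^ 2 = a ^ 14 + 28 * (a ^ 13 * b) + 364 * (a ^ 12 * b ^ 2)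
      + 16 * (147 * a ^ 11 * b ^ 3 + 441 * a ^ 10 * b ^ 4)"
    unfolding c_def by (simp add: power_numeral_reduce algebra_simps)
  finally show "(a + 2 * b) ^ 14 = a ^ 14 + 28 * (a ^ 13 * b) + 364 * (a ^ 12 * b ^ 2)
      + 16 * (147 * a ^ 11 * b ^ 3 + 441 * a ^ 10 * b ^ 4 + c * r + 4 * r ^ 2)"
    by (simp add: algebra_simps)
qed

text \<open>
  In the applications \<open>f\<close> is \<open>V\<close> or \<open>W(q^4)\<close>, \<open>g\<close> is a monomial in \<open>a\<close> and \<open>b\<close>, and \<open>h\<close> is a power
  of \<open>P(q^4)\<close>.
\<close>

lemma graded_4_nth_eq_0:
  assumes "graded 4 i f" "graded 4 j g" "graded 4 0 h" "(i + j) mod 4 \<noteq> 0"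
  shows "(f * g * h) $ (4 * n) = 0"
  using graded_mult[OF graded_mult[OF assms(1,2)] assms(3)]
proof (rule graded_nth_eq_0)
  show "\<not> [4 * n = i + j + 0] (mod 4)"
    using assms(4) by (simp add: cong_def)
qed

lemma opf_split:
  "opf = theta_fps * (dilate 4 theta_fps ^ 2 + 4 * odd_theta_fps ^ 2) * dilate 4 opf ^ 4"
proof -
  have "opf = theta_fps * (dilate 2 theta_fps * dilate 4 opf ^ 2) ^ 2"
    by (subst opf_eq) (simp only: dilate_2_opf)
  then show ?thesis
    by (simp only: power_mult_distrib dilate_theta_sq mult.assoc flip: power_mult) simp
qed

text \<open>
  The grading modulo 4 leaves, at exponents divisible by 4, the products of \<open>V\<close> with \<open>b^3\<close> and of
  \<open>4 W(q^4)\<close> with 1 and \<open>b^4\<close>. The last one has coefficient \<open>4 * 1296 = 64 * 81\<close>. In the first one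
  the coefficient 352 is divisible by 32, so the remaining factor is needed modulo 2 only, where
  \<open>V\<close> is \<open>b\<close> and the factors \<open>a\<close> and \<open>P(q^4)\<close> disappear.
\<close>

lemma square_theta_opf_nth_4:
  obtains c where "(square_fps * theta_fps ^ 2 * opf ^ 4) $ (4 * n)
    = 352 * (odd_theta_fps ^ 4) $ (4 * n) + 4 * (square_fps * (theta_fps ^ 14 * opf ^ 16)) $ n + 64 * c"
proof -
  define a b v w q where "a = dilate 4 theta_fps" and "b = odd_theta_fps"
    and "v = odd_square_fps" and "w = dilate 4 square_fps" and "q = dilate 4 opf ^ 16"
  have ga: "graded 4 0 (a ^ k)" and gb: "graded 4 k (b ^ k)" for k
    using graded_power[OF graded_dilate[of 4 4 theta_fps], of k]
      graded_power[OF graded_odd_theta_4, of k] by (simp_all add: a_def b_def)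
  have gab: "graded 4 j (a ^ k * b ^ j)" for k j
    using graded_mult[OF ga gb] by simp
  have gq: "graded 4 0 q"
    using graded_power[OF graded_dilate[of 4 4 opf], of 16] by (simp add: q_def)
  have gw: "graded 4 0 w" and gv: "graded 4 1 v"
    using graded_dilate[of 4 4 square_fps] graded_odd_square by (simp_all add: w_def v_def)
  have gab1: "graded 4 1 (a ^ k * b)" and ga0: "graded 4 0 (a ^ k)" for k
    using gab[where j = 1] ga by simp_all
  obtain R where R: "(a + 2 * b) ^ 6 * (a ^ 2 + 4 * b ^ 2) ^ 4 = a ^ 14 + 12 * (a ^ 13 * b)
      + 76 * (a ^ 12 * b ^ 2) + 352 * (a ^ 11 * b ^ 3) + 1296 * (a ^ 10 * b ^ 4)
      + 3904 * (a ^ 9 * b ^ 5) + 64 * R"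
    using expand_mod_64[of a b] by blast
  have "theta_fps ^ 2 * opf ^ 4 = theta_fps ^ 6 * (a ^ 2 + 4 * b ^ 2) ^ 4 * q"
    by (subst opf_split) (simp add: power_mult_distrib a_def b_def q_def mult_ac
        flip: power_mult power_add mult.assoc[of "theta_fps ^ _" "theta_fps ^ _"])
  also have "theta_fps ^ 6 = (a + 2 * b) ^ 6"
    unfolding a_def b_def by (subst theta_fps_split) (rule refl)
  finally have "square_fps * theta_fps ^ 2 * opf ^ 4
      = square_fps * ((a + 2 * b) ^ 6 * (a ^ 2 + 4 * b ^ 2) ^ 4 * q)"
    by (simp only: mult.assoc)
  also have "\<dots> = (v + 4 * w) * ((a + 2 * b) ^ 6 * (a ^ 2 + 4 * b ^ 2) ^ 4 * q)"
    unfolding v_def w_def by (subst square_fps_split) (rule refl)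
  also have "(v + 4 * w) * ((a + 2 * b) ^ 6 * (a ^ 2 + 4 * b ^ 2) ^ 4 * q) =
      352 * (v * (a ^ 11 * b ^ 3) * q) + 4 * (w * a ^ 14 * q)
      + (v * a ^ 14 * q + 12 * (v * (a ^ 13 * b) * q) + 76 * (v * (a ^ 12 * b ^ 2) * q)
        + 1296 * (v * (a ^ 10 * b ^ 4) * q) + 3904 * (v * (a ^ 9 * b ^ 5) * q))
      + (48 * (w * (a ^ 13 * b) * q) + 304 * (w * (a ^ 12 * b ^ 2) * q)
        + 1408 * (w * (a ^ 11 * b ^ 3) * q) + 15616 * (w * (a ^ 9 * b ^ 5) * q))
      + 64 * (81 * (w * (a ^ 10 * b ^ 4) * q) + (v + 4 * w) * R * q)"
    unfolding R by (simp add: algebra_simps)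
  finally have eq: "square_fps * theta_fps ^ 2 * opf ^ 4 = \<dots>" .
  \<comment> \<open>Modulo 2 the term with coefficient 352 is \<open>b ^ 4\<close>; the difference is split accordingly.\<close>
  have "2 dvd (v - b) * (a ^ 11 * b ^ 3 * q) + b ^ 4 * (a ^ 11 * q - 1)"
  proof (rule dvd_add)
    show "2 dvd (v - b) * (a ^ 11 * b ^ 3 * q)"
      unfolding v_def b_def by (rule dvd_mult2) (rule odd_square_cong_odd_theta)
    have "2 dvd theta_fps ^ 11 * opf ^ 16 - 1" by (rule theta_opf_cong_1)
    then obtain h where "theta_fps ^ 11 * opf ^ 16 - 1 = 2 * h" by (elim dvdE)
    from arg_cong[OF this, of "dilate 4"] have "a ^ 11 * q - 1 = 2 * dilate 4 h"
      by (simp add: fps_compose_sub_distrib dilate_mult dilate_power a_def q_def)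
    then have "2 dvd a ^ 11 * q - 1" by simp
    then show "2 dvd b ^ 4 * (a ^ 11 * q - 1)" by (rule dvd_mult)
  qed
  then have "2 dvd v * (a ^ 11 * b ^ 3) * q - b ^ 4"
    by (simp add: algebra_simps power_numeral_reduce)
  then have "2 dvd (v * (a ^ 11 * b ^ 3) * q - b ^ 4) $ (4 * n)" by (rule numeral_dvd_nth)
  then obtain d where d: "(v * (a ^ 11 * b ^ 3) * q) $ (4 * n) = (b ^ 4) $ (4 * n) + 2 * d"
    by (metis dvdE fps_sub_nth diff_eq_eq add.commute)
  have "w * a ^ 14 * q = dilate 4 (square_fps * (theta_fps ^ 14 * opf ^ 16))"
    by (simp add: w_def a_def q_def dilate_mult dilate_power mult.assoc)
  then have "(w * a ^ 14 * q) $ (4 * n) = (square_fps * (theta_fps ^ 14 * opf ^ 16)) $ n"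
    by (simp add: dilate_nth)
  moreover note
    graded_4_nth_eq_0[OF gv ga0 gq, of 14 n]
    graded_4_nth_eq_0[OF gv gab1 gq, of 13 n]
    graded_4_nth_eq_0[OF gv gab[of 2 12] gq, of n]
    graded_4_nth_eq_0[OF gv gab[of 4 10] gq, of n]
    graded_4_nth_eq_0[OF gv gab[of 5 9] gq, of n]
    graded_4_nth_eq_0[OF gw gab1 gq, of 13 n]
    graded_4_nth_eq_0[OF gw gab[of 2 12] gq, of n]
    graded_4_nth_eq_0[OF gw gab[of 3 11] gq, of n]
    graded_4_nth_eq_0[OF gw gab[of 5 9] gq, of n]
  ultimately have "(square_fps * theta_fps ^ 2 * opf ^ 4) $ (4 * n)
    = 352 * (b ^ 4) $ (4 * n) + 4 * (square_fps * (theta_fps ^ 14 * opf ^ 16)) $ n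
      + 64 * (11 * d + (81 * (w * (a ^ 10 * b ^ 4) * q) + (v + 4 * w) * R * q) $ (4 * n))"
    unfolding eq fps_add_nth fps_numeral_mult_nth d by simp
  then show ?thesis using that unfolding b_def by blast
qed

text \<open>
  Among the terms that survive modulo 16, only \<open>4 W(q^4) a^14\<close> has exponents divisible by 4.
\<close>

lemma square_theta14_nth_4:
  obtains c where "(square_fps * theta_fps ^ 14) $ (4 * n) = 4 * (square_fps * theta_fps ^ 14) $ n + 16 * c"
proof -
  define a b v w where "a = dilate 4 theta_fps" and "b = odd_theta_fps"
    and "v = odd_square_fps" and "w = dilate 4 square_fps"
  have ga: "graded 4 0 (a ^ k)" and gb: "graded 4 k (b ^ k)" for k
    using graded_power[OF graded_dilate[of 4 4 theta_fps], of k]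
      graded_power[OF graded_odd_theta_4, of k] by (simp_all add: a_def b_def)
  have gab: "graded 4 j (a ^ k * b ^ j)" for k j
    using graded_mult[OF ga gb] by simp
  have gab1: "graded 4 1 (a ^ k * b)" for k
    using gab[of 1] by simp
  have gw: "graded 4 0 w" and gv: "graded 4 1 v"
    using graded_dilate[of 4 4 square_fps] graded_odd_square by (simp_all add: w_def v_def)
  have g1: "graded 4 0 1" by (simp add: graded_def)
  obtain R where R: "(a + 2 * b) ^ 14 = a ^ 14 + 28 * (a ^ 13 * b) + 364 * (a ^ 12 * b ^ 2) + 16 * R"
    using expand_mod_16[of a b] by blast
  have "square_fps * theta_fps ^ 14 = (v + 4 * w) * (a + 2 * b) ^ 14"
    unfolding v_def w_def a_def b_def square_fps_split[symmetric] theta_fps_split[symmetric] ..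
  also have "\<dots> = v * a ^ 14 * 1 + 28 * (v * (a ^ 13 * b) * 1) + 364 * (v * (a ^ 12 * b ^ 2) * 1)
      + 4 * (w * a ^ 14) + 16 * (7 * (w * (a ^ 13 * b)) + 91 * (w * (a ^ 12 * b ^ 2)) + (v + 4 * w) * R)"
    unfolding R by (simp add: algebra_simps)
  finally have eq: "square_fps * theta_fps ^ 14 = \<dots>" .
  have "w * a ^ 14 = dilate 4 (square_fps * theta_fps ^ 14)"
    by (simp add: w_def a_def dilate_mult dilate_power)
  then have "(w * a ^ 14) $ (4 * n) = (square_fps * theta_fps ^ 14) $ n"
    by (simp add: dilate_nth)
  moreover note
    graded_4_nth_eq_0[OF gv ga[of 14] g1, of n]
    graded_4_nth_eq_0[OF gv gab1[of 13] g1, of n]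
    graded_4_nth_eq_0[OF gv gab[of 2 12] g1, of n]
  ultimately have "(square_fps * theta_fps ^ 14) $ (4 * n) = 4 * (square_fps * theta_fps ^ 14) $ n
     + 16 * ((7 * (w * (a ^ 13 * b)) + 91 * (w * (a ^ 12 * b ^ 2)) + (v + 4 * w) * R) $ (4 * n))"
    by (subst eq) (simp only: fps_add_nth fps_numeral_mult_nth, simp)
  then show ?thesis using that by blast
qed

theorem theorem12:
  fixes n k :: nat
  assumes "n > 0" and "\<not> is_square n" and "k \<in> {1, 2, 3, 4}"
  shows "[SOME_overline (4 ^ (k - 1) * n) = 0] (mod 2 ^ (2 * k + 1))"
proof -
  have sq: "numeral m dvd g - 1 \<Longrightarrow> (numeral m :: int) dvd (square_fps * g) $ n" for m g
    using assms(2) by (rule square_fps_mult_nth_dvd)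
  have k1: "8 dvd SOME_overline n"
  proof -
    have "2 dvd opf - 1" by (rule opf_cong_1)
    then obtain h where "opf - 1 = 2 * h" by (elim dvdE)
    from arg_cong[OF this, of "dilate 2"] have "dilate 2 opf - 1 = 2 * dilate 2 h"
      by (simp add: fps_compose_sub_distrib dilate_mult)
    then have "4 dvd dilate 2 opf ^ (2 * 1) - 1"
      by (intro even_power_dvd) simp
    from sq[OF this] show ?thesis unfolding SOME_overline_nth by auto
  qed
  have k2: "32 dvd SOME_overline (4 * n)"
  proof -
    have "4 dvd theta_fps ^ 2 * opf ^ 4 - 1"
      using even_power_dvd(1)[OF theta_opf_cong_1[of 1 2], of 1]
      by (simp add: power_mult_distrib flip: power_mult)
    from sq[OF this] show ?thesis unfolding SOME_overline_4 by (auto simp: mult.assoc)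
  qed
  have c14: "4 dvd (square_fps * (theta_fps ^ 14 * opf ^ 16)) $ n"
    using even_power_dvd(1)[OF theta_opf_cong_1[of 7 8], of 1]
    by (intro sq) (simp add: power_mult_distrib flip: power_mult)
  have k3: "128 dvd SOME_overline (4 * (4 * n))"
  proof -
    obtain c where "(square_fps * theta_fps ^ 2 * opf ^ 4) $ (4 * n)
      = 352 * (odd_theta_fps ^ 4) $ (4 * n) + 4 * (square_fps * (theta_fps ^ 14 * opf ^ 16)) $ n + 64 * c"
      by (rule square_theta_opf_nth_4)
    then show ?thesis unfolding SOME_overline_4 using c14 by presburger
  qed
  have k4: "512 dvd SOME_overline (4 * (4 * (4 * n)))"
  proof -
    obtain c where c: "(square_fps * theta_fps ^ 2 * opf ^ 4) $ (4 * (4 * n))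
      = 352 * (odd_theta_fps ^ 4) $ (4 * (4 * n))
        + 4 * (square_fps * (theta_fps ^ 14 * opf ^ 16)) $ (4 * n) + 64 * c"
      by (rule square_theta_opf_nth_4)
    have "(odd_theta_fps ^ 4) $ (4 * (4 * n)) = 0"
      using graded_power[OF graded_odd_theta, of 4]
    proof (rule graded_nth_eq_0)
      show "\<not> [4 * (4 * n) = 4 * 1] (mod 8)" unfolding cong_def by presburger
    qed
    moreover have "16 dvd (square_fps * (theta_fps ^ 14 * opf ^ 16)) $ (4 * n)"
    proof -
      have "16 dvd square_fps * theta_fps ^ 14 * (opf ^ 16 - 1)"
        by (intro dvd_mult even_power_dvd opf_cong_1)
      then have "16 dvd (square_fps * theta_fps ^ 14 * (opf ^ 16 - 1)) $ (4 * n)"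
        by (rule numeral_dvd_nth)
      then have 1: "16 dvd (square_fps * (theta_fps ^ 14 * opf ^ 16)) $ (4 * n)
          - (square_fps * theta_fps ^ 14) $ (4 * n)"
        by (simp add: right_diff_distrib mult.assoc)
      obtain d where 2: "(square_fps * theta_fps ^ 14) $ (4 * n)
          = 4 * (square_fps * theta_fps ^ 14) $ n + 16 * d"
        by (rule square_theta14_nth_4)
      have 3: "4 dvd (square_fps * theta_fps ^ 14) $ n"
        using even_power_dvd(1)[OF theta_opf_cong_1[of 7 0], of 1]
        by (intro sq) (simp flip: power_mult)
      from 1 2 3 show ?thesis by presburger
    qed
    ultimately show ?thesis unfolding SOME_overline_4 c by presburger
  qed
  show ?thesis
    using assms(3) k1 k2 k3 k4 by (auto simp: cong_0_iff)
qed

end
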